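(* Let $k$ be a positive integer and let $G$ be a finite simple $3$-degenerate graph with maximum degree $\Delta(G)\leq 2k-1$. Then $\chi'_l(G)\leq k$, i.e. $G$ has a $k$-linear coloring.
   Context: A graph is $t$-degenerate if every subgraph of it has a vertex of degree at most $t$ (equivalently, its vertices can be ordered so that each vertex has at most $t$ neighbors later in the ordering). A linear forest is a forest each of whose connected components is a path. A $k$-linear coloring of $G$ is a map $c:E(G)\to\{1,\dots,k\}$ such that each color class $c^{-1}(i)$ forms a linear forest (i.e. every vertex is incident with at most two edges of each color and there is no monochromatic cycle). The linear arboricity $\chi'_l(G)$ is the minimum $k$ for which $G$ has a $k$-linear coloring. *)

theory Defs
  imports Main
begin

text \<open>A graph is given by a vertex set \<open>V\<close> and a set \<open>E\<close> of two-element subsets of \<open>V\<close>.\<close>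

definition simple_graph :: "'a set \<Rightarrow> 'a set set \<Rightarrow> bool" where
  "simple_graph V E \<longleftrightarrow> (\<forall>e\<in>E. e \<subseteq> V \<and> card e = 2)"

definition subgraph_of :: "'a set \<Rightarrow> 'a set set \<Rightarrow> 'a set \<Rightarrow> 'a set set \<Rightarrow> bool" where
  "subgraph_of W F V E \<longleftrightarrow> simple_graph W F \<and> W \<subseteq> V \<and> F \<subseteq> E"

definition vertex_degree :: "'a set set \<Rightarrow> 'a \<Rightarrow> nat" where
  "vertex_degree E v = card {e \<in> E. v \<in> e}"

text \<open>The graph without vertices has maximum degree \<open>0\<close>.\<close>

definition max_degree :: "'a set \<Rightarrow> 'a set set \<Rightarrow> nat" where
  "max_degree V E = Max (insert 0 (vertex_degree E ` V))"

definition degenerate :: "nat \<Rightarrow> 'a set \<Rightarrow> 'a set set \<Rightarrow> bool" where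
  "degenerate t V E \<longleftrightarrow>
     (\<forall>W F. subgraph_of W F V E \<and> W \<noteq> {} \<longrightarrow> (\<exists>v\<in>W. vertex_degree F v \<le> t))"

definition consecutive_edges :: "'a list \<Rightarrow> 'a set set" where
  "consecutive_edges p = {{p ! i, p ! Suc i} | i. Suc i < length p}"

text \<open>A single vertex without edges counts as a path.\<close>

definition path_graph :: "'a set \<Rightarrow> 'a set set \<Rightarrow> bool" where
  "path_graph V E \<longleftrightarrow>
     (\<exists>p. p \<noteq> [] \<and> distinct p \<and> set p = V \<and> consecutive_edges p = E)"

definition cycle_in :: "'a set set \<Rightarrow> 'a list \<Rightarrow> bool" where
  "cycle_in E p \<longleftrightarrow>
     length p \<ge> 3 \<and> distinct p \<and> consecutive_edges p \<subseteq> E \<and> {last p, hd p} \<in> E"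

definition forest :: "'a set \<Rightarrow> 'a set set \<Rightarrow> bool" where
  "forest V E \<longleftrightarrow> simple_graph V E \<and> (\<nexists>p. cycle_in E p)"

definition component_vertices :: "'a set set \<Rightarrow> 'a \<Rightarrow> 'a set" where
  "component_vertices E v = {u. (v, u) \<in> {(x, y). {x, y} \<in> E}\<^sup>*}"

definition component_edges :: "'a set set \<Rightarrow> 'a \<Rightarrow> 'a set set" where
  "component_edges E v = {e \<in> E. e \<subseteq> component_vertices E v}"

definition linear_forest :: "'a set \<Rightarrow> 'a set set \<Rightarrow> bool" where
  "linear_forest V E \<longleftrightarrow>
     forest V E \<and> (\<forall>v\<in>V. path_graph (component_vertices E v) (component_edges E v))"

text \<open>Each color class is taken as a spanning subgraph; a vertex that it misses is a one-vertex
  component.\<close>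

definition linear_coloring :: "nat \<Rightarrow> 'a set \<Rightarrow> 'a set set \<Rightarrow> ('a set \<Rightarrow> nat) \<Rightarrow> bool" where
  "linear_coloring k V E c \<longleftrightarrow>
     c ` E \<subseteq> {1..k} \<and> (\<forall>i\<in>{1..k}. linear_forest V {e \<in> E. c e = i})"

definition linear_arboricity :: "'a set \<Rightarrow> 'a set set \<Rightarrow> nat" where
  "linear_arboricity V E = (LEAST k. \<exists>c. linear_coloring k V E c)"

end

theory Submission
  imports Defs
begin

text \<open>
  Induction on the number of edges. An edge \<open>uv\<close> with degree sum less than \<open>2k + 2\<close> is removed: by
  counting, some color occurs at most once at the two ends together, and it extends the coloring.
  Otherwise all degrees are at least 3, and a neighbor of a vertex of degree 3 has degree exactly
  \<open>2k - 1\<close>. Applying degeneracy to the vertices of degree greater than 3 and using the parity of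
  \<open>2k - 1\<close>, one finds a vertex \<open>v\<close> with two neighbors \<open>u\<close>, \<open>w\<close> of degree 3. A coloring of
  \<open>G - uv\<close> extends, after recoloring \<open>vw\<close> if necessary, unless the other two edges of \<open>u\<close> and the
  other two edges of \<open>w\<close> all have the same color. That exception is avoided: it cannot occur
  if \<open>u\<close> and \<open>w\<close> have the same neighbors, since it would create a monochromatic 4-cycle; if
  \<open>u\<close> and \<open>w\<close> are adjacent, \<open>uw\<close> is given a color seen at most once at its two ends together;
  and otherwise one colors the smaller 3-degenerate graph in which an edge \<open>wx\<close> has been
  replaced by \<open>ux\<close>, where the three edges at \<open>u\<close> cannot all have the same color.
\<close>

section \<open>Degrees and components\<close>

lemma vertex_degree_insert:
  assumes "finite E" "e \<notin> E"
  shows "vertex_degree (insert e E) x = vertex_degree E x + (if x \<in> e then 1 else 0)"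
proof -
  have "{f \<in> insert e E. x \<in> f} = (if x \<in> e then insert e {f \<in> E. x \<in> f} else {f \<in> E. x \<in> f})"
    by auto
  then show ?thesis using assms by (simp add: vertex_degree_def)
qed

lemma vertex_degree_remove:
  assumes "finite E" "e \<in> E"
  shows "vertex_degree E x = vertex_degree (E - {e}) x + (if x \<in> e then 1 else 0)"
  using vertex_degree_insert[of "E - {e}" e x] assms by (simp add: insert_absorb)

lemma vertex_degree_mono: "finite E \<Longrightarrow> F \<subseteq> E \<Longrightarrow> vertex_degree F x \<le> vertex_degree E x"
  unfolding vertex_degree_def by (intro card_mono) auto

lemma vertex_degree_eq_0_iff: "finite E \<Longrightarrow> vertex_degree E x = 0 \<longleftrightarrow> (\<forall>e\<in>E. x \<notin> e)"
  by (auto simp: vertex_degree_def)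

lemma component_refl [simp]: "x \<in> component_vertices E x"
  by (simp add: component_vertices_def)

lemma component_sym: "y \<in> component_vertices E x \<Longrightarrow> x \<in> component_vertices E y"
proof -
  have "sym {(x, y). {x, y} \<in> E}" by (auto simp: sym_def insert_commute)
  then have "sym ({(x, y). {x, y} \<in> E}\<^sup>*)" by (rule sym_rtrancl)
  then show "y \<in> component_vertices E x \<Longrightarrow> x \<in> component_vertices E y"
    by (auto simp: component_vertices_def dest: symD)
qed

lemma component_trans:
  "y \<in> component_vertices E x \<Longrightarrow> z \<in> component_vertices E y \<Longrightarrow> z \<in> component_vertices E x"
  by (auto simp: component_vertices_def)

lemma component_eq: "y \<in> component_vertices E x \<Longrightarrow> component_vertices E y = component_vertices E x"
  by (intro equalityI subsetI) (auto intro: component_trans component_sym)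

lemma component_mono: "E \<subseteq> F \<Longrightarrow> component_vertices E x \<subseteq> component_vertices F x"
  unfolding component_vertices_def using rtrancl_mono[of "{(x, y). {x, y} \<in> E}" "{(x, y). {x, y} \<in> F}"]
  by auto

lemma component_edge: "{x, y} \<in> E \<Longrightarrow> y \<in> component_vertices E x"
  by (auto simp: component_vertices_def)

text \<open>Induction along the walk from \<open>x\<close>: crossing the new edge moves between the
  disjuncts, and crossing it back returns to an earlier one, so at most one crossing need be
  recorded.\<close>

lemma component_insertD:
  assumes "y \<in> component_vertices (insert {u, v} E) x"
  shows "y \<in> component_vertices E x
    \<or> u \<in> component_vertices E x \<and> y \<in> component_vertices E v
    \<or> v \<in> component_vertices E x \<and> y \<in> component_vertices E u"
proof -
  have "(x, y) \<in> {(x, y). {x, y} \<in> insert {u, v} E}\<^sup>*"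
    using assms by (simp add: component_vertices_def)
  then show ?thesis
  proof (induction rule: rtrancl_induct)
    case base
    show ?case by simp
  next
    case (step y z)
    from step.hyps(2) consider "{y, z} \<in> E" | "y = u" "z = v" | "y = v" "z = u"
      by (auto simp: doubleton_eq_iff)
    then show ?case
      using step.IH by cases (auto intro: component_trans component_edge)
  qed
qed

lemma component_isolated:
  assumes "finite E" "vertex_degree E x = 0" "y \<in> component_vertices E x"
  shows "y = x"
proof -
  have "(x, y) \<in> {(x, y). {x, y} \<in> E}\<^sup>*" using assms by (simp add: component_vertices_def)
  then show ?thesis
    using assms(1,2) by (cases rule: converse_rtranclE) (auto simp: vertex_degree_eq_0_iff)
qed

section \<open>Linear forests as edge sets\<close>

text \<open>Acyclicity is expressed by requiring every edge to be a bridge, which behaves well under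
  insertion and removal of edges.\<close>

definition linear_edges :: "'a set set \<Rightarrow> bool" where
  "linear_edges F \<longleftrightarrow> finite F \<and> (\<forall>e\<in>F. card e = 2) \<and> (\<forall>x. vertex_degree F x \<le> 2) \<and>
     (\<forall>x y. {x, y} \<in> F \<longrightarrow> y \<notin> component_vertices (F - {{x, y}}) x)"

lemma linear_edgesD:
  assumes "linear_edges F"
  shows "finite F" "e \<in> F \<Longrightarrow> card e = 2" "vertex_degree F x \<le> 2"
    "{x, y} \<in> F \<Longrightarrow> y \<notin> component_vertices (F - {{x, y}}) x"
  using assms by (auto simp: linear_edges_def)

lemma linear_edges_subset:
  assumes "linear_edges F" "G \<subseteq> F"
  shows "linear_edges G"
proof -
  have "finite G" using assms finite_subset by (auto simp: linear_edges_def)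
  moreover have "vertex_degree G x \<le> 2" for x
    using vertex_degree_mono[of F G x] linear_edgesD(1)[OF assms(1)] linear_edgesD(3)[OF assms(1), of x] assms(2)
    by auto
  moreover have "y \<notin> component_vertices (G - {{x, y}}) x" if "{x, y} \<in> G" for x y
    using component_mono[of "G - {{x, y}}" "F - {{x, y}}" x] linear_edgesD(4)[OF assms(1), of x y]
      that assms(2) by blast
  ultimately show ?thesis using assms by (auto simp: linear_edges_def)
qed

text \<open>The new edge joins two different components and hence is a bridge. An old edge remains a
  bridge, since a detour around it through \<open>{u, v}\<close> would already connect
  \<open>u\<close> and \<open>v\<close> in \<open>F\<close>.\<close>

lemma linear_edges_insert:
  assumes F: "linear_edges F" and "u \<noteq> v"
    and "vertex_degree F u \<le> 1" "vertex_degree F v \<le> 1" and uv: "v \<notin> component_vertices F u"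
  shows "linear_edges (insert {u, v} F)"
proof -
  note FD = linear_edgesD[OF F]
  have nin: "{u, v} \<notin> F" using uv component_edge by metis
  have "vertex_degree (insert {u, v} F) x \<le> 2" for x
    using vertex_degree_insert[OF FD(1) nin, of x] FD(3)[of x] assms(3,4) by auto
  moreover have "y \<notin> component_vertices (insert {u, v} F - {{x, y}}) x"
    if xy: "{x, y} \<in> insert {u, v} F" for x y
  proof (cases "{x, y} = {u, v}")
    case True
    then have "insert {u, v} F - {{x, y}} = F" using nin by auto
    moreover have "x = u \<and> y = v \<or> x = v \<and> y = u" using True by (auto simp: doubleton_eq_iff)
    ultimately show ?thesis using uv component_sym by fastforce
  next
    case False
    let ?F = "F - {{x, y}}"
    have eq: "insert {u, v} F - {{x, y}} = insert {u, v} ?F" using False by auto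
    have inF: "{x, y} \<in> F" using xy False by auto
    have mono: "z' \<in> component_vertices F z" if "z' \<in> component_vertices ?F z" for z z'
      using that component_mono[of ?F F z] by auto
    show ?thesis
    proof
      assume "y \<in> component_vertices (insert {u, v} F - {{x, y}}) x"
      from component_insertD[OF this[unfolded eq]] FD(4)[OF inF]
      have "u \<in> component_vertices F x \<and> y \<in> component_vertices F v
        \<or> v \<in> component_vertices F x \<and> y \<in> component_vertices F u"
        using mono by blast
      then have "v \<in> component_vertices F u"
        using component_edge[OF inF] by (meson component_sym component_trans)
      then show False using uv by simp
    qed
  qed
  ultimately show ?thesis using FD \<open>u \<noteq> v\<close> by (auto simp: linear_edges_def)
qed

text \<open>A component is a path and has only two ends. The induction peels off the edge at
  \<open>a\<close>; its other end \<open>a'\<close> then plays the role of \<open>a\<close> in a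
  smaller edge set.\<close>

lemma not_three_ends:
  assumes "linear_edges F" "distinct [a, b, c]"
    and "vertex_degree F a \<le> 1" "vertex_degree F b \<le> 1" "vertex_degree F c \<le> 1"
    and "b \<in> component_vertices F a" "c \<in> component_vertices F a"
  shows False
  using assms
proof (induction "card F" arbitrary: F a rule: less_induct)
  case less
  note FD = linear_edgesD[OF less.prems(1)]
  have "vertex_degree F a \<noteq> 0"
    using component_isolated[of F a b] FD less.prems by auto
  then obtain e where e: "e \<in> F" "a \<in> e"
    using FD(1) by (auto simp: vertex_degree_eq_0_iff)
  moreover have "card e = 2" using FD(2) e by auto
  ultimately obtain a' where a': "e = {a, a'}" "a' \<noteq> a"
    by (auto simp: card_2_iff doubleton_eq_iff insert_commute)
  define G where "G = F - {e}"
  have F: "F = insert {a, a'} G" using e a' G_def by auto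
  have linG: "linear_edges G" using less.prems(1) linear_edges_subset G_def by blast
  note fin = linear_edgesD(1)[OF linG]
  have deg: "vertex_degree F x = vertex_degree G x + (if x \<in> e then 1 else 0)" for x
    unfolding G_def using FD(1) e by (intro vertex_degree_remove)
  have a0: "vertex_degree G a = 0" using deg[of a] e less.prems by simp
  \<comment> \<open>Without \<open>e\<close> the vertex \<open>a\<close> is isolated, so the rest of
    its old component is reached from \<open>a'\<close>.\<close>
  have step: "z \<in> component_vertices G a'" if "z \<in> component_vertices F a" "z \<noteq> a" for z
    using component_insertD[of z a a' G a] that component_isolated[OF fin a0] a'(2)
    unfolding F by blast
  have b: "b \<in> component_vertices G a'" and c: "c \<in> component_vertices G a'"
    using step less.prems by auto
  have d': "vertex_degree F a' = vertex_degree G a' + 1" using deg[of a'] a' by simp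
  have mono: "vertex_degree G x \<le> vertex_degree F x" for x using deg[of x] by simp
  consider "a' = b" | "a' = c" | "distinct [a', b, c]" using less.prems by auto
  then show False
  proof cases
    case 1
    then have "vertex_degree G b = 0" using d' less.prems by simp
    then show False using component_isolated[OF fin, of b c] c 1 less.prems(2) by auto
  next
    case 2
    then have "vertex_degree G c = 0" using d' less.prems by simp
    then show False using component_isolated[OF fin, of c b] b 2 less.prems(2) by auto
  next
    case 3
    have "card G < card F" unfolding G_def using FD(1) e by (simp only: card_Diff1_less)
    moreover have "vertex_degree G a' \<le> 1" using d' FD(3)[of a'] by simp
    ultimately show False
      using less.hyps[of G a'] linG 3 b c mono[of b] mono[of c] less.prems by auto
  qed
qed

section \<open>Paths and cycles as vertex lists\<close>

lemma consecutive_edges_simps [simp]: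
  "consecutive_edges [] = {}" "consecutive_edges [x] = {}"
  "consecutive_edges (x # y # p) = insert {x, y} (consecutive_edges (y # p))"
proof -
  show "consecutive_edges (x # y # p) = insert {x, y} (consecutive_edges (y # p))"
  proof (intro equalityI subsetI)
    fix e assume "e \<in> consecutive_edges (x # y # p)"
    then obtain i where "Suc i < length (x # y # p)" "e = {(x # y # p) ! i, (x # y # p) ! Suc i}"
      by (auto simp: consecutive_edges_def)
    then show "e \<in> insert {x, y} (consecutive_edges (y # p))"
      by (cases i) (auto simp: consecutive_edges_def)
  next
    fix e assume "e \<in> insert {x, y} (consecutive_edges (y # p))"
    then consider "e = {x, y}"
      | i where "Suc i < length (y # p)" "e = {(y # p) ! i, (y # p) ! Suc i}"
      by (auto simp: consecutive_edges_def)
    then show "e \<in> consecutive_edges (x # y # p)"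
    proof cases
      case 1
      then show ?thesis by (auto simp: consecutive_edges_def intro!: exI[of _ 0])
    next
      case (2 i)
      then show ?thesis by (auto simp: consecutive_edges_def intro!: exI[of _ "Suc i"])
    qed
  qed
qed (auto simp: consecutive_edges_def)

lemma consecutive_edges_nth: "Suc i < length p \<Longrightarrow> {p ! i, p ! Suc i} \<in> consecutive_edges p"
  unfolding consecutive_edges_def by blast

lemma consecutive_edges_append:
  "p \<noteq> [] \<Longrightarrow> q \<noteq> [] \<Longrightarrow>
    consecutive_edges (p @ q) = insert {last p, hd q} (consecutive_edges p \<union> consecutive_edges q)"
proof (induction p)
  case (Cons x p)
  then show ?case by (cases p; cases q) auto
qed simp

lemma consecutive_edges_rev: "consecutive_edges (rev p) = consecutive_edges p"
proof (induction p)
  case (Cons x p)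
  then show ?case
    by (cases "p = []")
      (simp_all add: consecutive_edges_append insert_commute last_rev consecutive_edges_append[of "[x]" p, simplified])
qed simp

text \<open>An interior vertex of the list lies on two distinct consecutive edges.\<close>

lemma path_end:
  assumes "finite F" "distinct p" "a \<in> set p" "consecutive_edges p \<subseteq> F" "vertex_degree F a \<le> 1"
  shows "a = hd p \<or> a = last p"
proof (rule ccontr)
  assume neg: "\<not> ?thesis"
  obtain i where i: "i < length p" "a = p ! i" using assms by (auto simp: in_set_conv_nth)
  have "p \<noteq> []" using assms by auto
  then have "i \<noteq> 0" "i \<noteq> length p - 1" using neg i by (metis hd_conv_nth last_conv_nth)+
  then obtain j where j: "i = Suc j" "Suc i < length p" using i by (cases i) auto
  have "{{p ! j, p ! i}, {p ! i, p ! Suc i}} \<subseteq> {e \<in> F. a \<in> e}"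
    using assms(4) i j consecutive_edges_nth[of j p] consecutive_edges_nth[of i p] by auto
  moreover have "finite {e \<in> F. a \<in> e}" using assms by simp
  ultimately have "card {{p ! j, p ! i}, {p ! i, p ! Suc i}} \<le> vertex_degree F a"
    unfolding vertex_degree_def by (intro card_mono)
  moreover have "p ! j \<noteq> p ! i" "p ! j \<noteq> p ! Suc i" using assms(2) i j by (auto simp: nth_eq_iff_index_eq)
  ultimately show False using assms(5) by (auto simp: doubleton_eq_iff)
qed

text \<open>Reversing the list if necessary brings the chosen end into last position, ready for
  gluing two paths.\<close>

lemma path_graph_with_last:
  assumes "finite F" "path_graph A D" "a \<in> A" "D \<subseteq> F" "vertex_degree F a \<le> 1"
  obtains p where "p \<noteq> []" "distinct p" "set p = A" "consecutive_edges p = D" "last p = a"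
proof -
  obtain p where p: "p \<noteq> []" "distinct p" "set p = A" "consecutive_edges p = D"
    using assms by (auto simp: path_graph_def)
  then have "a = hd p \<or> a = last p" using assms path_end[of F p a] by auto
  then show thesis
    using that[of p] that[of "rev p"] p by (auto simp: consecutive_edges_rev last_rev)
qed

text \<open>Edges are inserted one at a time. A new edge joins two components that are paths by
  induction, at vertices of degree at most 1, that is, at ends of these paths.\<close>

lemma linear_edges_path_graph:
  assumes "linear_edges F"
  shows "path_graph (component_vertices F v) (component_edges F v)"
proof -
  have "finite F" using assms by (rule linear_edgesD)
  then show ?thesis using assms
  proof (induction F arbitrary: v rule: finite_induct)
    case empty
    have "component_vertices {} v = {v}" by (simp add: component_vertices_def)
    then show ?case
      unfolding path_graph_def component_edges_def by (intro exI[of _ "[v]"]) simp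
  next
    case (insert e F)
    note lin = \<open>linear_edges (insert e F)\<close>
    have linF: "linear_edges F" using lin by (rule linear_edges_subset) auto
    note IH = insert.IH[OF linF]
    have "card e = 2" using lin by (auto simp: linear_edges_def)
    then obtain a b where e: "e = {a, b}" "a \<noteq> b" by (auto simp: card_2_iff)
    let ?A = "component_vertices F a" and ?B = "component_vertices F b"
    have ab: "b \<notin> ?A" using linear_edgesD(4)[OF lin, of a b] e insert.hyps by simp
    have dab: "vertex_degree F a \<le> 1" "vertex_degree F b \<le> 1"
      using vertex_degree_insert[OF insert.hyps, of a] vertex_degree_insert[OF insert.hyps, of b]
        linear_edgesD(3)[OF lin, of a] linear_edgesD(3)[OF lin, of b] e by auto
    have disj: "?A \<inter> ?B = {}" 
    proof (intro equals0I)
      fix z assume "z \<in> ?A \<inter> ?B"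
      then have "?A = ?B" using component_eq[of z F a] component_eq[of z F b] by simp
      then show False using ab by simp
    qed
    have mono: "component_vertices F x \<subseteq> component_vertices (insert e F) x" for x
      by (rule component_mono) auto
    have edge: "b \<in> component_vertices (insert e F) a" using e by (intro component_edge) auto
    show ?case
    proof (cases "v \<in> ?A \<union> ?B")
      case False
      then have v: "a \<notin> component_vertices F v" "b \<notin> component_vertices F v"
        using component_sym[of a F v] component_sym[of b F v] by auto
      have "component_vertices (insert e F) v \<subseteq> component_vertices F v"
        using component_insertD[of _ a b F v] v unfolding e by auto
      then have "component_vertices (insert e F) v = component_vertices F v"
        using mono[of v] by simp
      moreover from this have "component_edges (insert e F) v = component_edges F v"
        using v e by (auto simp: component_edges_def)
      ultimately show ?thesis using IH by simp
    next
      case True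
      have V: "component_vertices (insert e F) v = ?A \<union> ?B"
      proof
        show "component_vertices (insert e F) v \<subseteq> ?A \<union> ?B"
        proof
          fix z assume "z \<in> component_vertices (insert e F) v"
          then consider "z \<in> component_vertices F v" | "z \<in> ?A" | "z \<in> ?B"
            using component_insertD[of z a b F v] unfolding e by blast
          then show "z \<in> ?A \<union> ?B"
            using True component_eq[of v F a] component_eq[of v F b] by cases auto
        qed
        have "component_vertices (insert e F) v = component_vertices (insert e F) a"
          using True mono[of a] mono[of b] component_eq[of v "insert e F" a]
            component_eq[of v "insert e F" b] component_eq[OF edge] by auto
        then show "?A \<union> ?B \<subseteq> component_vertices (insert e F) v"
          using mono[of a] mono[of b] component_eq[OF edge] by auto
      qed
      have E: "component_edges (insert e F) v = insert e (component_edges F a \<union> component_edges F b)"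
      proof -
        have "f \<subseteq> ?A \<or> f \<subseteq> ?B" if "f \<in> F" "f \<subseteq> ?A \<union> ?B" for f
        proof -
          have "card f = 2" using linear_edgesD(2)[OF linF that(1)] .
          then obtain x y where f: "f = {x, y}" by (auto simp: card_2_iff)
          then have "y \<in> component_vertices F x" using that component_edge by metis
          then show ?thesis
            using that(2) component_eq[of x F a] component_eq[of x F b] component_eq[of y F x]
            unfolding f by auto
        qed
        then show ?thesis unfolding component_edges_def V using e by auto
      qed
      obtain p where p: "p \<noteq> []" "distinct p" "set p = ?A" "consecutive_edges p = component_edges F a"
        "last p = a"
        using path_graph_with_last[OF insert.hyps(1) IH[of a] component_refl _ dab(1)]
        by (auto simp: component_edges_def)
      obtain q where q: "q \<noteq> []" "distinct q" "set q = ?B" "consecutive_edges q = component_edges F b"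
        "last q = b"
        using path_graph_with_last[OF insert.hyps(1) IH[of b] component_refl _ dab(2)]
        by (auto simp: component_edges_def)
      \<comment> \<open>The first list stops at \<open>a\<close> and the reversed second one starts
        at \<open>b\<close>, so the junction contributes exactly \<open>e\<close>.\<close>
      have "consecutive_edges (p @ rev q) = component_edges (insert e F) v"
        unfolding E using p q e by (simp add: consecutive_edges_append consecutive_edges_rev hd_rev)
      then show ?thesis
        unfolding path_graph_def V using p q disj by (intro exI[of _ "p @ rev q"]) auto
    qed
  qed
qed

lemma component_consecutive_edges:
  "p \<noteq> [] \<Longrightarrow> last p \<in> component_vertices (consecutive_edges p) (hd p)"
proof (induction p)
  case (Cons x p)
  show ?case
  proof (cases p)
    case (Cons y q)
    have "last p \<in> component_vertices (consecutive_edges (x # p)) y"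
      using Cons.IH component_mono[of "consecutive_edges p" "consecutive_edges (x # p)" y] Cons
      by (auto simp: subset_insertI)
    moreover have "y \<in> component_vertices (consecutive_edges (x # p)) x"
      using Cons by (intro component_edge) auto
    ultimately have "last p \<in> component_vertices (consecutive_edges (x # p)) x"
      by (rule component_trans[rotated])
    then show ?thesis using Cons by simp
  qed simp
qed simp

text \<open>The first and last positions are adjacent only in a list of length two, where the
  closing edge is the path itself; hence the length bound.\<close>

lemma closing_edge_not_consecutive:
  assumes "distinct p" "length p \<ge> 3"
  shows "{hd p, last p} \<notin> consecutive_edges p"
proof
  assume "{hd p, last p} \<in> consecutive_edges p"
  then obtain i where i: "Suc i < length p" "{p ! 0, p ! (length p - 1)} = {p ! i, p ! Suc i}"
    using assms by (cases "p = []") (auto simp: consecutive_edges_def hd_conv_nth last_conv_nth)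
  then have "(0 = i \<and> length p - 1 = Suc i) \<or> (0 = Suc i \<and> length p - 1 = i)"
    using assms nth_eq_iff_index_eq[OF assms(1)] unfolding doubleton_eq_iff
    by (metis Suc_lessD diff_less length_greater_0_conv less_numeral_extra(1) list.size(3) not_numeral_le_zero)
  then show False using assms by auto
qed

text \<open>The rest of a cycle connects the ends of its closing edge, which would then not be a
  bridge.\<close>

lemma linear_edges_linear_forest:
  assumes F: "linear_edges F" and "simple_graph V F"
  shows "linear_forest V F"
proof -
  have "\<not> cycle_in F p" for p
  proof
    assume p: "cycle_in F p"
    then have "p \<noteq> []" by (auto simp: cycle_in_def)
    let ?e = "{hd p, last p}"
    have e: "?e \<in> F" using p by (simp add: cycle_in_def insert_commute)
    have "consecutive_edges p \<subseteq> F - {?e}"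
      using p closing_edge_not_consecutive[of p] by (auto simp: cycle_in_def)
    then have "last p \<in> component_vertices (F - {?e}) (hd p)"
      using component_consecutive_edges[OF \<open>p \<noteq> []\<close>] component_mono[of _ _ "hd p"] by (meson subsetD)
    then show False using linear_edgesD(4)[OF F e] by simp
  qed
  then show ?thesis
    using assms linear_edges_path_graph[OF F] by (simp add: linear_forest_def forest_def)
qed


section \<open>Colorings with linear color classes\<close>

definition color_class :: "'a set set \<Rightarrow> ('a set \<Rightarrow> nat) \<Rightarrow> nat \<Rightarrow> 'a set set" where
  "color_class E c i = {e \<in> E. c e = i}"

definition color_degree :: "'a set set \<Rightarrow> ('a set \<Rightarrow> nat) \<Rightarrow> nat \<Rightarrow> 'a \<Rightarrow> nat" where
  "color_degree E c i x = vertex_degree (color_class E c i) x"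

text \<open>The vertex set is dropped, and linearity is asked of every \<open>i\<close> without a
  range: classes outside \<open>{1..k}\<close> are empty.\<close>

definition lin_col :: "nat \<Rightarrow> 'a set set \<Rightarrow> ('a set \<Rightarrow> nat) \<Rightarrow> bool" where
  "lin_col k E c \<longleftrightarrow> finite E \<and> c ` E \<subseteq> {1..k} \<and> (\<forall>i. linear_edges (color_class E c i))"

lemma lin_colD:
  assumes "lin_col k E c"
  shows "finite E" "e \<in> E \<Longrightarrow> c e \<in> {1..k}" "linear_edges (color_class E c i)"
    "finite (color_class E c i)" "color_degree E c i x \<le> 2"
  using assms linear_edgesD(1,3)[of "color_class E c i"]
  by (auto simp: lin_col_def color_degree_def image_subset_iff)

lemma color_class_insert:
  "e \<notin> E \<Longrightarrow> color_class (insert e E) (c(e := j)) i =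
    (if i = j then insert e (color_class E c i) else color_class E c i)"
  by (auto simp: color_class_def)

lemma color_degree_insert:
  assumes "finite E" "e \<notin> E"
  shows "color_degree (insert e E) (c(e := j)) i x =
    color_degree E c i x + (if i = j \<and> x \<in> e then 1 else 0)"
  using vertex_degree_insert[of "color_class E c i" e x] assms
  unfolding color_degree_def color_class_insert[OF assms(2)] by (auto simp: color_class_def)

lemma color_degree_remove:
  assumes "finite E" "e \<in> E"
  shows "color_degree E c i x =
    color_degree (E - {e}) c i x + (if i = c e \<and> x \<in> e then 1 else 0)"
  using color_degree_insert[of "E - {e}" e c "c e" i x] assms by (simp add: insert_absorb)

lemma vertex_degree_sum_colors:
  assumes "lin_col k E c"
  shows "vertex_degree E x = (\<Sum>i\<in>{1..k}. color_degree E c i x)"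
proof -
  have "{e \<in> E. x \<in> e} = (\<Union>i\<in>{1..k}. {e \<in> color_class E c i. x \<in> e})"
    using lin_colD(2)[OF assms] by (auto simp: color_class_def)
  moreover have "card (\<Union>i\<in>{1..k}. {e \<in> color_class E c i. x \<in> e})
    = (\<Sum>i\<in>{1..k}. card {e \<in> color_class E c i. x \<in> e})"
    using lin_colD(1)[OF assms] by (intro card_UN_disjoint) (auto simp: color_class_def)
  ultimately show ?thesis by (simp add: vertex_degree_def color_degree_def)
qed

lemma sum_color_degree_le:
  assumes "lin_col k E c" "I \<subseteq> {1..k}"
  shows "(\<Sum>i\<in>I. color_degree E c i x) \<le> vertex_degree E x"
  unfolding vertex_degree_sum_colors[OF assms(1)] using assms(2) by (intro sum_mono2) auto

lemma lin_col_subset: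
  assumes "lin_col k E c" "F \<subseteq> E"
  shows "lin_col k F c"
proof -
  have "linear_edges (color_class F c i)" for i
    using linear_edges_subset[of "color_class E c i" "color_class F c i"] assms
    by (auto simp: lin_col_def color_class_def)
  moreover have "finite F" using lin_colD(1)[OF assms(1)] assms(2) by (rule finite_subset[rotated])
  ultimately show ?thesis using assms unfolding lin_col_def by blast
qed

section \<open>Extending a coloring to one or two further edges\<close>

lemma lin_col_insert:
  assumes "lin_col k E c" "{u, v} \<notin> E" "u \<noteq> v" "i \<in> {1..k}"
    and "color_degree E c i u \<le> 1" "color_degree E c i v \<le> 1"
    and "v \<notin> component_vertices (color_class E c i) u"
  shows "lin_col k (insert {u, v} E) (c({u, v} := i))"
proof -
  have "linear_edges (insert {u, v} (color_class E c i))"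
    using assms lin_colD(3)[OF assms(1)] by (intro linear_edges_insert) (auto simp: color_degree_def)
  then show ?thesis
    using assms by (auto simp: lin_col_def color_class_insert)
qed

lemma color_isolated:
  assumes "lin_col k E c" "color_degree E c i u = 0" "u \<noteq> v"
  shows "v \<notin> component_vertices (color_class E c i) u"
    "u \<notin> component_vertices (color_class E c i) v"
  using component_isolated[of "color_class E c i" u v] lin_colD(4)[OF assms(1), of i] assms(2,3)
    component_sym[of u "color_class E c i" v]
  by (auto simp: color_degree_def)

text \<open>One of the two ends misses color \<open>i\<close>, so it is isolated in that class and
  no cycle can close.\<close>

lemma lin_col_insert_slack:
  assumes "lin_col k E c" "{u, v} \<notin> E" "u \<noteq> v" "i \<in> {1..k}"
    and "color_degree E c i u + color_degree E c i v \<le> 1"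
  shows "lin_col k (insert {u, v} E) (c({u, v} := i))"
proof (rule lin_col_insert)
  have "color_degree E c i u = 0 \<or> color_degree E c i v = 0" using assms by linarith
  then show "v \<notin> component_vertices (color_class E c i) u"
    using color_isolated[OF assms(1), of i u v] color_isolated[OF assms(1), of i v u] assms(3) by auto
qed (use assms in auto)

text \<open>Averaging: \<open>k\<close> colors with at least two occurrences each would need degree
  sum \<open>2 * k\<close>.\<close>

lemma ex_slack_color:
  assumes "lin_col k E c" "vertex_degree E u + vertex_degree E v < 2 * k"
  shows "\<exists>i\<in>{1..k}. color_degree E c i u + color_degree E c i v \<le> 1"
proof (rule ccontr)
  assume "\<not> ?thesis"
  then have "(\<Sum>i\<in>{1..k}. 2) \<le> (\<Sum>i\<in>{1..k}. color_degree E c i u + color_degree E c i v)"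
    by (intro sum_mono) force
  then show False
    using assms(2) vertex_degree_sum_colors[OF assms(1)] by (simp add: sum.distrib)
qed

text \<open>If no color fits \<open>{u, v}\<close> directly, \<open>{v, w}\<close> is moved to
  another color and its old color \<open>j\<close> goes to \<open>{u, v}\<close>. The condition
  \<open>nobad\<close> excludes the case where the color of both edges at \<open>u\<close> is
  blocked at \<open>w\<close>.\<close>

lemma extend_by_recoloring:
  assumes col: "lin_col k E c" and dist: "distinct [u, v, w]"
    and vw: "{v, w} \<in> E" and uv: "{u, v} \<notin> E"
    and deg: "vertex_degree E u \<le> 2" "vertex_degree E v + 2 \<le> 2 * k" "vertex_degree E w \<le> 3"
    and nobad: "\<And>i. color_degree E c i u = 2 \<Longrightarrow> color_degree (E - {{v, w}}) c i w \<noteq> 2"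
  shows "\<exists>c'. lin_col k (insert {u, v} E) c'"
proof (rule ccontr)
  assume no: "\<not> ?thesis"
  let ?d = "color_degree E c"
  define E' where "E' = E - {{v, w}}"
  define j where "j = c {v, w}"
  note colD = lin_colD[OF col]
  note sums = vertex_degree_sum_colors[OF col]
  have E: "E = insert {v, w} E'" and nin: "{v, w} \<notin> E'" using vw E'_def by auto
  have col': "lin_col k E' c" using col by (rule lin_col_subset) (auto simp: E'_def)
  have j: "j \<in> {1..k}" using colD(2) vw j_def by auto
  have d: "?d i x = color_degree E' c i x + (if i = j \<and> (x = v \<or> x = w) then 1 else 0)" for i x
    using color_degree_remove[OF colD(1) vw, of c i x] by (simp add: E'_def j_def)
  have same: "color_class E' c i = color_class E c i" if "i \<noteq> j" for i
    using that by (auto simp: color_class_def E'_def j_def)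
  \<comment> \<open>Otherwise \<open>{u, v}\<close> could receive color \<open>i\<close> at
    once.\<close>
  have conn: "v \<in> component_vertices (color_class E c i) u"
    if "i \<in> {1..k}" "?d i u \<le> 1" "?d i v \<le> 1" for i
    using no lin_col_insert[OF col uv, of i] that dist by auto
  have ge2: "2 \<le> ?d i u + ?d i v" if "i \<in> {1..k}" for i
    using no lin_col_insert_slack[OF col uv, of i] that dist by fastforce
  have le2: "(\<Sum>i\<in>{1..k}. ?d i u + ?d i v) \<le> (\<Sum>i\<in>{1..k}. 2)"
    using deg sums[of u] sums[of v] by (simp add: sum.distrib)
  \<comment> \<open>Every color occurs at least twice at \<open>u\<close> and \<open>v\<close>
    together, and the total is at most \<open>2 * k\<close>, so every color is tight.\<close>
  have two: "?d i u + ?d i v = 2" if "i \<in> {1..k}" for i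
  proof (rule ccontr)
    assume "?d i u + ?d i v \<noteq> 2"
    then have "2 < ?d i u + ?d i v" using ge2[OF that] by simp
    then have "(\<Sum>i\<in>{1..k}. 2) < (\<Sum>i\<in>{1..k}. ?d i u + ?d i v)"
      using ge2 that by (intro sum_strict_mono_ex1) auto
    then show False using le2 by simp
  qed
  have "(\<Sum>i\<in>{1..k}. ?d i u + ?d i v) = (\<Sum>i\<in>{1..k}. 2)" using two by (intro sum.cong) auto
  then have degu: "(\<Sum>i\<in>{1..k}. ?d i u) = 2"
    using deg sums[of u] sums[of v] by (simp add: sum.distrib)
  have other: "\<exists>b\<in>{1..k}. b \<noteq> i \<and> ?d b u = 1" if i: "i \<in> {1..k}" "?d i u = 1" for i
  proof -
    have 1: "(\<Sum>b\<in>{1..k} - {i}. ?d b u) = 1"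
      using degu sum.remove[of "{1..k}" i "\<lambda>b. ?d b u"] i by simp
    then obtain b where b: "b \<in> {1..k} - {i}" "?d b u \<noteq> 0" by (metis sum.neutral zero_neq_one)
    then have "?d b u \<le> 1" using 1 member_le_sum[of b "{1..k} - {i}" "\<lambda>b. ?d b u"] by simp
    then show ?thesis using b by (intro bexI[of _ b]) auto
  qed
  \<comment> \<open>Otherwise \<open>u\<close>, \<open>v\<close> and \<open>w\<close> would be three
    ends of one path.\<close>
  have end_w: "w \<notin> component_vertices (color_class E c i) v"
    if "i \<in> {1..k}" "?d i u = 1" "?d i w \<le> 1" for i
  proof
    assume w: "w \<in> component_vertices (color_class E c i) v"
    have "?d i v = 1" using two[of i] that by simp
    moreover from this have "u \<in> component_vertices (color_class E c i) v"
      using conn[of i] that by (intro component_sym[of v]) auto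
    ultimately show False
      using not_three_ends[OF colD(3)[of i], of v u w] w that dist by (auto simp: color_degree_def)
  qed
  \<comment> \<open>Moving \<open>{v, w}\<close> to \<open>i\<close> lowers color \<open>j\<close>
    at \<open>v\<close> by one. Then \<open>j\<close> is absent at one of \<open>u\<close>,
    \<open>v\<close> and occurs at most once at the other, so \<open>{u, v}\<close> can take
    it.\<close>
  have recolor: False
    if i: "i \<in> {1..k}" "i \<noteq> j" "?d i v \<le> 1" "?d i w \<le> 1"
      "w \<notin> component_vertices (color_class E c i) v"
    and u: "?d j u \<le> 1" "?d j v \<le> 2" "?d j u = 0 \<or> ?d j v \<le> 1" for i
  proof -
    let ?c = "c({v, w} := i)"
    have dj: "color_degree E ?c j x = color_degree E' c j x" for x
      using color_degree_insert[OF _ nin, of c i j x] i colD(1) E by simp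
    have col'': "lin_col k E ?c"
      unfolding E using i d same dist by (intro lin_col_insert[OF col' nin]) auto
    have "color_degree E' c j u = ?d j u" "color_degree E' c j v = ?d j v - 1"
      using d[of j u] d[of j v] dist by auto
    then have "color_degree E ?c j u \<le> 1" "color_degree E ?c j v \<le> 1"
      "color_degree E ?c j u = 0 \<or> color_degree E ?c j v = 0"
      unfolding dj using u by auto
    then have "lin_col k (insert {u, v} E) (?c({u, v} := j))"
      using dist by (intro lin_col_insert_slack[OF col'' uv _ j]) auto
    then show False using no by blast
  qed
  have jv: "?d j v \<ge> 1" "?d j w \<ge> 1" using d[of j v] d[of j w] by auto
  consider "?d j u = 1" | "?d j u = 0" using two[OF j] jv by linarith
  then show False
  proof cases
    case 1
    then obtain b where b: "b \<in> {1..k}" "b \<noteq> j" "?d b u = 1" using other[OF j] by auto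
    \<comment> \<open>The edge \<open>{v, w}\<close> puts \<open>w\<close> on the path of color
      \<open>j\<close> between \<open>v\<close> and \<open>u\<close>, so \<open>w\<close> is an
      inner vertex with two edges of color \<open>j\<close>. This leaves at most one edge of color
      \<open>b\<close> at \<open>w\<close>.\<close>
    have "w \<in> component_vertices (color_class E c j) v"
      using vw by (intro component_edge) (auto simp: color_class_def j_def)
    then have "?d j w \<ge> 2" using end_w[OF j 1] by force
    moreover have "?d j w + ?d b w \<le> 3"
      using sum_color_degree_le[OF col, of "{j, b}" w] j b deg by simp
    ultimately have "?d b w \<le> 1" by linarith
    then show False
      using recolor[of b] end_w[of b] b two[of b] two[OF j] 1 by simp
  next
    case 2
    obtain i where i: "i \<in> {1..k}" "?d i u \<noteq> 0" using degu by (metis sum.neutral zero_neq_numeral)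
    then have ij: "i \<noteq> j" using 2 by auto
    consider "?d i u = 1" | "?d i u = 2" using i two[of i] by linarith
    then show False
    proof cases
      case 1
      then obtain b where b: "b \<in> {1..k}" "b \<noteq> i" "?d b u = 1" using other[of i] i by auto
      then have bj: "b \<noteq> j" using 2 by auto
      \<comment> \<open>Color \<open>j\<close> uses up at least one of the at most three edges at
        \<open>w\<close>, so \<open>i\<close> and \<open>b\<close> cannot both occur twice
        there.\<close>
      have "?d j w + (?d i w + ?d b w) \<le> 3"
        using sum_color_degree_le[OF col, of "{j, i, b}" w] j b i ij bj deg by simp
      then consider "?d i w \<le> 1" | "?d b w \<le> 1" using jv by linarith
      then show False
        using recolor[of b] recolor[of i] end_w[of b] end_w[of i] i ij b bj 1 2
          two[of b] two[of i] two[OF j] by cases simp_all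
    next
      case 2
      \<comment> \<open>Both edges at \<open>u\<close> have color \<open>i\<close>, so by tightness
        \<open>v\<close> misses \<open>i\<close> and recoloring \<open>{v, w}\<close> closes no
        cycle.\<close>
      have v0: "?d i v = 0" using two[of i] i 2 by simp
      have "?d i w \<noteq> 2" using nobad[of i] 2 d[of i w] ij by (simp add: E'_def)
      then have "?d i w \<le> 1" using colD(5)[of i w] by simp
      then show False
        using recolor[of i] v0 i ij two[OF j] color_isolated(1)[OF col v0, of w] dist
          \<open>?d j u = 0\<close> by simp
    qed
  qed
qed

text \<open>A color with slack goes to \<open>{v, w}\<close> first, then recoloring handles
  \<open>{u, v}\<close>. Here \<open>nobad\<close> speaks of the graph before both
  insertions.\<close>

lemma extend_two_edges:
  assumes col: "lin_col k E c" and dist: "distinct [u, v, w]"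
    and nin: "{u, v} \<notin> E" "{v, w} \<notin> E"
    and deg: "vertex_degree E u \<le> 2" "vertex_degree E w \<le> 2" "vertex_degree E v + 3 \<le> 2 * k"
    and nobad: "\<And>i. color_degree E c i u = 2 \<Longrightarrow> color_degree E c i w \<noteq> 2"
  shows "\<exists>c'. lin_col k (insert {u, v} (insert {v, w} E)) c'"
proof -
  have "vertex_degree E v + vertex_degree E w < 2 * k" using deg by linarith
  then obtain i where i: "i \<in> {1..k}" "color_degree E c i v + color_degree E c i w \<le> 1"
    using ex_slack_color[OF col] by blast
  let ?c = "c({v, w} := i)" and ?E = "insert {v, w} E"
  have fin: "finite E" using col by (rule lin_colD)
  note dE = vertex_degree_insert[OF fin nin(2)]
  note dc = color_degree_insert[OF fin nin(2), of c i]
  have E: "?E - {{v, w}} = E" using nin by simp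
  have old: "color_degree E ?c l x = color_degree E c l x" for l x
  proof -
    have "color_class E ?c l = color_class E c l" using nin(2) by (auto simp: color_class_def)
    then show ?thesis by (simp add: color_degree_def)
  qed
  show ?thesis
  proof (rule extend_by_recoloring)
    show "lin_col k ?E ?c" using col nin(2) _ i by (rule lin_col_insert_slack) (use dist in auto)
    show "{u, v} \<notin> ?E" using nin dist by (auto simp: doubleton_eq_iff)
    show "color_degree (?E - {{v, w}}) ?c l w \<noteq> 2" if "color_degree ?E ?c l u = 2" for l
      using nobad[of l] that dist unfolding E old dc by auto
  qed (use dist deg dE in auto)
qed

section \<open>The inductive step\<close>

lemma ex_two_cubic_neighbors:
  assumes "finite V" and E: "simple_graph V E" "degenerate 3 V E" "E \<noteq> {}"
    and deg: "\<And>x. vertex_degree E x < 2 * k"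
    and big: "\<And>u v. {u, v} \<in> E \<Longrightarrow> 2 * k + 2 \<le> vertex_degree E u + vertex_degree E v"
  obtains u v w where "distinct [u, v, w]" "{u, v} \<in> E" "{v, w} \<in> E"
    "vertex_degree E u = 3" "vertex_degree E w = 3"
proof -
  have fin: "finite E"
    using E(1) \<open>finite V\<close> finite_subset[of E "Pow V"] by (auto simp: simple_graph_def)
  define W where "W = {x \<in> V. vertex_degree E x > 3}"
  define F where "F = {e \<in> E. e \<subseteq> W}"
  have V: "x \<in> V" if "e \<in> E" "x \<in> e" for e x using that E(1) by (auto simp: simple_graph_def)
  \<comment> \<open>The other end has degree at most \<open>2 * k - 1\<close>, so every end of an
    edge has degree at least 3.\<close>
  have deg3: "vertex_degree E u = 3" if "{u, v} \<in> E" "u \<notin> W" for u v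
    using big[OF that(1)] deg[of v] that V[OF that(1), of u] by (auto simp: W_def)
  have odd: "vertex_degree E v + 1 = 2 * k" if "{u, v} \<in> E" "vertex_degree E u = 3" for u v
    using big[OF that(1)] deg[of v] that by simp
  have other: "\<exists>u. e = {u, v} \<and> u \<noteq> v" if "e \<in> E" "v \<in> e" for e v
  proof -
    have "card e = 2" using that E(1) by (auto simp: simple_graph_def)
    then show ?thesis using that(2) by (auto simp: card_2_iff insert_commute)
  qed
  \<comment> \<open>The alternative \<open>W = {}\<close> covers the graphs whose edges all join
    cubic vertices. In both cases an edge at \<open>v\<close> outside \<open>F\<close> has its other
    end outside \<open>W\<close>.\<close>
  have "\<exists>v. (v \<in> W \<or> W = {}) \<and> vertex_degree F v + 2 \<le> vertex_degree E v"
  proof (cases "W = {}")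
    case True
    obtain e where e: "e \<in> E" using E by auto
    then have "card e = 2" using E by (auto simp: simple_graph_def)
    then obtain v where v: "v \<in> e" by (metis card.empty ex_in_conv zero_neq_numeral)
    then obtain u where "e = {v, u}" using other[OF e v] by (auto simp: insert_commute)
    then have "vertex_degree E v = 3" using deg3[of v u] e True by simp
    moreover have "F = {}" using E True by (auto simp: F_def simple_graph_def)
    ultimately show ?thesis using True by (intro exI[of _ v]) (simp add: vertex_degree_def)
  next
    case False
    have "subgraph_of W F V E"
      using E(1) by (auto simp: subgraph_of_def simple_graph_def W_def F_def)
    then obtain v where v: "v \<in> W" "vertex_degree F v \<le> 3"
      using E(2) False by (auto simp: degenerate_def)
    then have v4: "vertex_degree E v > 3" by (simp add: W_def)
    have "\<not> {e \<in> E. v \<in> e} \<subseteq> {e \<in> F. v \<in> e}"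
    proof
      assume "{e \<in> E. v \<in> e} \<subseteq> {e \<in> F. v \<in> e}"
      then have "vertex_degree E v \<le> vertex_degree F v"
        unfolding vertex_degree_def using fin by (intro card_mono) (auto simp: F_def)
      then show False using v v4 by simp
    qed
    then obtain e where e: "e \<in> E" "v \<in> e" "e \<notin> F" by auto
    then obtain u where u: "e = {u, v}" using other by blast
    then have "u \<notin> W" using e v by (auto simp: F_def)
    then have "vertex_degree E v + 1 = 2 * k" using odd[of u v] deg3[of u v] u e by auto
    \<comment> \<open>The degree of \<open>v\<close> in \<open>E\<close> is odd and exceeds 3, hence
      is at least 5; parity thus turns one edge leaving \<open>W\<close> into two.\<close>
    then have "vertex_degree F v + 2 \<le> vertex_degree E v" using v v4 by presburger
    then show ?thesis using v by blast
  qed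
  then obtain v where v: "v \<in> W \<or> W = {}" "vertex_degree F v + 2 \<le> vertex_degree E v" by auto
  have "card ({e \<in> E. v \<in> e} - {e \<in> F. v \<in> e}) = vertex_degree E v - vertex_degree F v"
    unfolding vertex_degree_def using fin by (intro card_Diff_subset) (auto simp: F_def)
  then have "2 \<le> card ({e \<in> E. v \<in> e} - {e \<in> F. v \<in> e})" using v by simp
  then obtain S where S: "S \<subseteq> {e \<in> E. v \<in> e} - {e \<in> F. v \<in> e}" "card S = 2"
    by (rule obtain_subset_with_card_n)
  then obtain e f where ef: "e \<noteq> f" "e \<in> S" "f \<in> S" by (auto simp: card_2_iff)
  then have "e \<in> E" "f \<in> E" "v \<in> e" "v \<in> f" "e \<notin> F" "f \<notin> F" using S by auto
  then obtain u w where uw: "e = {u, v}" "u \<noteq> v" "f = {w, v}" "w \<noteq> v" using other by metis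
  have "u \<notin> W" "w \<notin> W" using uw v(1) \<open>e \<in> E\<close> \<open>f \<in> E\<close> \<open>e \<notin> F\<close> \<open>f \<notin> F\<close> by (auto simp: F_def)
  then have "vertex_degree E u = 3" "vertex_degree E w = 3"
    using deg3 uw \<open>e \<in> E\<close> \<open>f \<in> E\<close> by auto
  then show thesis
    using that[of u v w] uw ef \<open>e \<in> E\<close> \<open>f \<in> E\<close> by (auto simp: insert_commute)
qed

section \<open>Colorings that avoid the exceptional pattern at \<open>u\<close> and
  \<open>w\<close>\<close>

lemma all_edges_colored:
  assumes "finite E" "vertex_degree E x \<le> color_degree E c i x" "e \<in> E" "x \<in> e"
  shows "c e = i"
proof -
  have "{e \<in> color_class E c i. x \<in> e} = {e \<in> E. x \<in> e}"
    using assms by (intro card_seteq) (auto simp: color_degree_def vertex_degree_def color_class_def)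
  then have "e \<in> color_class E c i" using assms by blast
  then show ?thesis by (simp add: color_class_def)
qed

lemma color_degree_le: "finite E \<Longrightarrow> color_degree E c i x \<le> vertex_degree E x"
  unfolding color_degree_def by (rule vertex_degree_mono) (auto simp: color_class_def)

text \<open>The other three sides form a detour around \<open>{w, x}\<close>, which therefore is no
  bridge.\<close>

lemma no_monochromatic_square:
  assumes "linear_edges F" "distinct [w, x, u, y]"
    "{w, x} \<in> F" "{x, u} \<in> F" "{u, y} \<in> F" "{y, w} \<in> F"
  shows False
proof -
  let ?F = "F - {{w, x}}"
  have "y \<in> component_vertices ?F w" "u \<in> component_vertices ?F y" "x \<in> component_vertices ?F u"
    using assms by (auto intro!: component_edge simp: doubleton_eq_iff insert_commute)
  then have "x \<in> component_vertices ?F w" by (meson component_trans)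
  then show False using linear_edgesD(4)[OF assms(1,3)] by simp
qed

text \<open>All three edges at \<open>u\<close> cannot share the color of \<open>{u, x}\<close>; this color passes to \<open>{w, x}\<close>.\<close>

lemma coloring_by_moving_edge:
  assumes col: "lin_col k (insert {u, x} E) c" and nin: "{u, x} \<notin> E"
    and dist: "distinct [u, w, x, y]"
    and w: "vertex_degree E w = 0"
    and y: "vertex_degree E y + 1 < 2 * k"
  shows "\<exists>c'. lin_col k (insert {w, y} (insert {w, x} E)) c' \<and>
    (\<forall>i. color_degree (insert {w, y} (insert {w, x} E)) c' i u = 2 \<longrightarrow>
         color_degree (insert {w, y} (insert {w, x} E)) c' i w \<noteq> 2)"
proof -
  define a where "a = c {u, x}"
  let ?G = "insert {u, x} E" and ?E3 = "insert {w, x} E"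
  let ?c3 = "c({w, x} := a)"
  have fin: "finite E" using lin_colD(1)[OF col] by simp
  have colE: "lin_col k E c" using col by (rule lin_col_subset) auto
  have a: "a \<in> {1..k}" using lin_colD(2)[OF col] a_def by auto
  have dG: "color_degree ?G c i z = color_degree E c i z + (if i = a \<and> (z = u \<or> z = x) then 1 else 0)"
    for i z using color_degree_remove[of ?G "{u, x}" c i z] fin nin by (simp add: a_def)
  have nin3: "{w, x} \<notin> E" "{w, y} \<notin> E" using w fin by (auto simp: vertex_degree_eq_0_iff)
  then have nin4: "{w, y} \<notin> ?E3" using dist by (auto simp: doubleton_eq_iff)
  have w0: "color_degree E c i w = 0" for i using color_degree_le[OF fin, of c i w] w by simp
  have "color_degree E c a x \<le> 1" using dG[of a x] lin_colD(5)[OF col, of a x] by simp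
  then have col3: "lin_col k ?E3 ?c3"
    using w0 dist by (intro lin_col_insert_slack[OF colE nin3(1) _ a]) auto
  have fin3: "finite ?E3" using fin by simp
  note d3 = color_degree_insert[OF fin nin3(1), of c a]
  \<comment> \<open>At this stage \<open>{w, x}\<close> is the only edge at \<open>w\<close>, which
    leaves slack for \<open>{w, y}\<close>.\<close>
  have "vertex_degree ?E3 w + vertex_degree ?E3 y < 2 * k"
    using vertex_degree_insert[OF fin nin3(1), of w] vertex_degree_insert[OF fin nin3(1), of y] w y dist
    by auto
  then obtain b where b: "b \<in> {1..k}" "color_degree ?E3 ?c3 b w + color_degree ?E3 ?c3 b y \<le> 1"
    using ex_slack_color[OF col3] by blast
  let ?E4 = "insert {w, y} ?E3" and ?c4 = "?c3({w, y} := b)"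
  have col4: "lin_col k ?E4 ?c4" using col3 nin4 _ b by (rule lin_col_insert_slack) (use dist in auto)
  note d4 = color_degree_insert[OF fin3 nin4, of ?c3 b]
  have "color_degree ?E4 ?c4 i w \<noteq> 2" if "color_degree ?E4 ?c4 i u = 2" for i
  proof
    assume "color_degree ?E4 ?c4 i w = 2"
    \<comment> \<open>Only two edges meet \<open>w\<close>, and \<open>{w, x}\<close> has color
      \<open>a\<close>. With \<open>{u, x}\<close> counted, \<open>a\<close> would occur three times
      at \<open>u\<close> in \<open>?G\<close>.\<close>
    then have "i = a" unfolding d4 d3 w0 by (simp split: if_splits)
    moreover have "color_degree E c i u = 2" using that dist unfolding d4 d3 by simp
    ultimately show False using dG[of a u] lin_colD(5)[OF col, of a u] by simp
  qed
  then show ?thesis using col4 by blast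
qed

text \<open>The strict degree bound avoids truncated subtraction and forces \<open>k\<close> to be
  positive.\<close>

lemma degenerate_lin_col:
  assumes "finite V" "simple_graph V E" "degenerate 3 V E" "\<And>x. vertex_degree E x < 2 * k"
  shows "\<exists>c. lin_col k E c"
  using assms(2-)
proof (induction "card E" arbitrary: E rule: less_induct)
  case less
  note E = less.prems(1,2) and deg = less.prems(3)
  have fin: "finite E"
    using E(1) \<open>finite V\<close> finite_subset[of E "Pow V"] by (auto simp: simple_graph_def)
  have neq: "x \<noteq> y" if "{x, y} \<in> E" for x y using that E(1) by (auto simp: simple_graph_def)
  \<comment> \<open>Proper subsets inherit all hypotheses. The graph with a moved edge is not a
    subset of \<open>E\<close> and goes through \<open>less.hyps\<close> directly.\<close>
  have IH: "\<exists>c. lin_col k F c" if "F \<subset> E" for F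
  proof (rule less.hyps)
    show "card F < card E" using fin that by (rule psubset_card_mono)
    show "simple_graph V F" using E(1) that by (auto simp: simple_graph_def)
    show "degenerate 3 V F" using E(2) that unfolding degenerate_def subgraph_of_def
      by (meson psubset_imp_subset subset_trans)
    show "vertex_degree F x < 2 * k" for x
      using vertex_degree_mono[OF fin, of F x] deg[of x] that by auto
  qed
  show ?case
  proof (cases "E = {} \<or> (\<exists>u v. {u, v} \<in> E \<and> vertex_degree E u + vertex_degree E v < 2 * k + 2)")
    case True
    show ?thesis
    proof (cases "E = {}")
      case True
      then show ?thesis
        by (auto simp: lin_col_def linear_edges_def color_class_def vertex_degree_def)
    next
      case False
      then obtain u v where uv: "{u, v} \<in> E" "vertex_degree E u + vertex_degree E v < 2 * k + 2"
        using True by auto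
      let ?F = "E - {{u, v}}"
      obtain c where c: "lin_col k ?F c" using IH[of ?F] uv by auto
      have "vertex_degree ?F u + vertex_degree ?F v < 2 * k"
        using uv vertex_degree_remove[OF fin uv(1), of u] vertex_degree_remove[OF fin uv(1), of v]
        by simp
      then obtain i where "i \<in> {1..k}" "color_degree ?F c i u + color_degree ?F c i v \<le> 1"
        using ex_slack_color[OF c] by blast
      then have "lin_col k (insert {u, v} ?F) (c({u, v} := i))"
        using neq uv by (intro lin_col_insert_slack[OF c]) auto
      then show ?thesis using uv by (auto simp: insert_absorb)
    qed
  next
    case False
    then have "2 * k + 2 \<le> vertex_degree E u + vertex_degree E v" if "{u, v} \<in> E" for u v
      using that by (meson not_le)
    then obtain u v w where dist: "distinct [u, v, w]" and uv: "{u, v} \<in> E" and vw: "{v, w} \<in> E"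
      and u3: "vertex_degree E u = 3" and w3: "vertex_degree E w = 3"
      using ex_two_cubic_neighbors[OF \<open>finite V\<close> E _ deg] False by metis
    define E1 where "E1 = E - {{u, v}, {v, w}}"
    have fin1: "finite E1" using fin E1_def by simp
    have ne: "{u, v} \<noteq> {v, w}" using dist by (auto simp: doubleton_eq_iff)
    have EE: "E = insert {u, v} (insert {v, w} E1)" using uv vw E1_def by auto
    have nin: "{v, w} \<notin> E1" "{u, v} \<notin> E1" "{u, v} \<notin> insert {v, w} E1" using ne E1_def by auto
    have dE: "vertex_degree E x = vertex_degree E1 x + (if x \<in> {v, w} then 1 else 0)
      + (if x \<in> {u, v} then 1 else 0)" for x
      unfolding EE using vertex_degree_insert[OF fin1 nin(1), of x]
        vertex_degree_insert[OF _ nin(3), of x] fin1 by simp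
    have d1: "vertex_degree E1 u = 2" "vertex_degree E1 w = 2" "vertex_degree E1 v + 3 \<le> 2 * k"
      using dE[of u] dE[of v] dE[of w] dist u3 w3 deg[of v] by auto
    have sub1: "E1 \<subset> E" using uv E1_def by auto
    have neighbor: "\<exists>y. e = {x, y}" if "e \<in> E" "x \<in> e" for e x
    proof -
      have "card e = 2" using that E(1) by (auto simp: simple_graph_def)
      then show ?thesis using that(2) by (auto simp: card_2_iff insert_commute)
    qed
    \<comment> \<open>Both \<open>u\<close> and \<open>w\<close> have degree 2 in \<open>E1\<close>,
      so the aim is that their four edge ends do not all carry one color.\<close>
    have "\<exists>c. lin_col k E1 c \<and>
      (\<forall>i. color_degree E1 c i u = 2 \<longrightarrow> color_degree E1 c i w \<noteq> 2)"
    proof (cases "{u, w} \<in> E")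
      case True
      let ?F = "E1 - {{u, w}}"
      have uw: "{u, w} \<in> E1" using True dist by (auto simp: E1_def doubleton_eq_iff)
      have finF: "finite ?F" using fin1 by simp
      have F1: "insert {u, w} ?F = E1" using uw by auto
      obtain c where c: "lin_col k ?F c" using IH[of ?F] sub1 by auto
      have dF: "vertex_degree ?F u = 1" "vertex_degree ?F w = 1"
        using d1 vertex_degree_remove[OF fin1 uw, of u] vertex_degree_remove[OF fin1 uw, of w] by auto
      \<comment> \<open>The degree sum 2 is below \<open>2 * k\<close> because a vertex of degree 3
        exists.\<close>
      then obtain i where i: "i \<in> {1..k}" "color_degree ?F c i u + color_degree ?F c i w \<le> 1"
        using ex_slack_color[OF c, of u w] u3 deg[of u] by auto
      have "lin_col k (insert {u, w} ?F) (c({u, w} := i))"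
        using i dist by (intro lin_col_insert_slack[OF c]) auto
      moreover have "color_degree E1 (c({u, w} := i)) l w \<noteq> 2"
        if "color_degree E1 (c({u, w} := i)) l u = 2" for l
        using color_degree_insert[OF finF, of "{u, w}" c i l u]
          color_degree_insert[OF finF, of "{u, w}" c i l w]
          color_degree_le[OF finF, of c l u] dF i that unfolding F1 by (auto split: if_splits)
      ultimately show ?thesis unfolding F1 by blast
    next
      case uw: False
      show ?thesis
      proof (cases "\<exists>x. {w, x} \<in> E1 \<and> {u, x} \<notin> E")
        case True
        then obtain x where x: "{w, x} \<in> E1" "{u, x} \<notin> E" by auto
        have dw: "vertex_degree (E1 - {{w, x}}) w = 1"
          using vertex_degree_remove[OF fin1 x(1), of w] d1 by simp
        then have "\<exists>e\<in>E1 - {{w, x}}. w \<in> e"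
          using vertex_degree_eq_0_iff[of "E1 - {{w, x}}" w] fin1 by auto
        then obtain y where y: "{w, y} \<in> E1 - {{w, x}}" using neighbor sub1 by blast
        define E2 where "E2 = E1 - {{w, x}} - {{w, y}}"
        have fin2: "finite E2" using fin1 E2_def by simp
        have inE: "{w, x} \<in> E" "{w, y} \<in> E" using x y sub1 by auto
        have dist4: "distinct [u, w, x, y]"
          using dist neq[OF inE(1)] neq[OF inE(2)] x y uw inE by (auto simp: insert_commute)
        have E12: "E1 = insert {w, y} (insert {w, x} E2)" using x y E2_def by auto
        have dE1: "vertex_degree E1 z = vertex_degree E2 z + (if z \<in> {w, y} then 1 else 0)
            + (if z \<in> {w, x} then 1 else 0)" for z
          using vertex_degree_remove[OF fin1 x(1), of z]
            vertex_degree_remove[OF _ y, of z] fin1 by (simp add: E2_def)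
        have w0: "vertex_degree E2 w = 0" using dE1[of w] d1 by simp
        \<comment> \<open>Replacing \<open>{w, x}\<close> by \<open>{u, x}\<close> and leaving out
          \<open>{w, y}\<close> isolates \<open>w\<close> and makes \<open>u\<close> cubic
          again.\<close>
        let ?G = "insert {u, x} E2"
        have nin2: "{u, x} \<notin> E2" using x sub1 E2_def by auto
        have dG: "vertex_degree ?G z = vertex_degree E2 z + (if z \<in> {u, x} then 1 else 0)" for z
          using fin2 nin2 by (rule vertex_degree_insert)
        have dGu: "vertex_degree ?G u = 3" using dG[of u] dE1[of u] d1 dist4 by simp
        have "\<exists>c. lin_col k ?G c"
        proof (rule less.hyps)
          \<comment> \<open>\<open>E1\<close> lacks two edges of \<open>E\<close>, so there is room
            for one new edge.\<close>
          have "card E = card E1 + 2" using EE nin fin1 by simp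
          moreover have "card E2 \<le> card E1" using fin1 by (intro card_mono) (auto simp: E2_def)
          ultimately show "card ?G < card E" using fin2 nin2 by simp
          have "u \<in> V" "x \<in> V" using E(1) uv inE by (auto simp: simple_graph_def)
          then show "simple_graph V ?G"
            using E(1) sub1 dist4 by (auto simp: simple_graph_def E2_def)
          show "vertex_degree ?G z < 2 * k" for z
            using dG[of z] dE1[of z] dE[of z] deg[of z] dist4 by (auto split: if_splits)
          show "degenerate 3 V ?G"
            unfolding degenerate_def
          proof (intro allI impI, elim conjE)
            fix U F assume F: "subgraph_of U F V ?G" and "U \<noteq> {}"
            show "\<exists>z\<in>U. vertex_degree F z \<le> 3"
            \<comment> \<open>\<open>u\<close> itself has degree 3 in \<open>?G\<close>; a subgraph
              avoiding \<open>u\<close> misses the new edge and lies in \<open>E\<close>.\<close>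
            proof (cases "u \<in> U")
              case True
              have "vertex_degree F u \<le> vertex_degree ?G u"
                using F fin2 by (intro vertex_degree_mono) (auto simp: subgraph_of_def)
              then show ?thesis using True dGu by auto
            next
              case False
              then have "{u, x} \<notin> F" using F by (auto simp: subgraph_of_def simple_graph_def)
              then have "subgraph_of U F V E"
                using F sub1 by (auto simp: subgraph_of_def E2_def)
              then show ?thesis using E(2) \<open>U \<noteq> {}\<close> by (auto simp: degenerate_def)
            qed
          qed
        qed
        then obtain c where c: "lin_col k ?G c" ..
        have "vertex_degree E2 y + 1 < 2 * k" using dE1[of y] dE[of y] deg[of y] dist4 by simp
        then show ?thesis
          unfolding E12 by (rule coloring_by_moving_edge[OF c nin2 dist4 w0])
      next
        case False
        \<comment> \<open>Now both remaining neighbors of \<open>w\<close> are neighbors of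
          \<open>u\<close>, and the exceptional pattern would be a monochromatic square.\<close>
        have "card {e \<in> E1. w \<in> e} = 2" using d1 by (simp add: vertex_degree_def)
        then obtain e f where ef: "e \<noteq> f" "e \<in> E1" "w \<in> e" "f \<in> E1" "w \<in> f"
          by (auto simp: card_2_iff)
        then obtain x y where xy: "e = {w, x}" "f = {w, y}" 
          using neighbor[of e w] neighbor[of f w] sub1 by auto
        then have "{w, x} \<in> E1" "{w, y} \<in> E1" "x \<noteq> y" using ef by auto
        moreover have "x \<noteq> v" "y \<noteq> v" using calculation nin by (auto simp: insert_commute)
        moreover have "{u, x} \<in> E" "{u, y} \<in> E" using False calculation by auto
        ultimately have sq: "{w, x} \<in> E1" "{w, y} \<in> E1" "{u, x} \<in> E1" "{u, y} \<in> E1" "x \<noteq> y"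
          using dist by (auto simp: E1_def doubleton_eq_iff)
        have dsq: "distinct [w, x, u, y]"
          using sq neq[of w x] neq[of w y] neq[of u x] neq[of u y] sub1 dist by auto
        obtain c where c: "lin_col k E1 c" using IH[OF sub1] ..
        have "color_degree E1 c i w \<noteq> 2" if "color_degree E1 c i u = 2" for i
        proof
          assume "color_degree E1 c i w = 2"
          then have "{{w, x}, {x, u}, {u, y}, {y, w}} \<subseteq> color_class E1 c i"
            using that sq d1 all_edges_colored[OF fin1, of w c i] all_edges_colored[OF fin1, of u c i]
            by (auto simp: color_class_def insert_commute)
          then show False using no_monochromatic_square[OF lin_colD(3)[OF c] dsq] by auto
        qed
        then show ?thesis using c by blast
      qed
    qed
    then show ?thesis
      using extend_two_edges[of k E1 _ u v w] dist nin d1 unfolding EE by auto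
  qed
qed

theorem theorem1:
  fixes V :: "'a set" and E :: "'a set set" and k :: nat
  assumes "k \<ge> 1"
    and "finite V" and "simple_graph V E"
    and "degenerate 3 V E"
    and "max_degree V E \<le> 2 * k - 1"
  shows "linear_arboricity V E \<le> k \<and> (\<exists>c. linear_coloring k V E c)"
proof -
  \<comment> \<open>The bound is needed for every element of the type; outside \<open>V\<close> the
    degree is 0.\<close>
  have "vertex_degree E x < 2 * k" for x
  proof (cases "x \<in> V")
    case True
    then have "vertex_degree E x \<le> max_degree V E"
      unfolding max_degree_def using assms(2) by (intro Max_ge) auto
    then show ?thesis using assms by linarith
  next
    case False
    then have none: "{e \<in> E. x \<in> e} = {}" using assms(3) by (auto simp: simple_graph_def)
    show ?thesis unfolding vertex_degree_def none using assms(1) by simp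
  qed
  then obtain c where c: "lin_col k E c" using degenerate_lin_col assms by blast
  have "linear_forest V {e \<in> E. c e = i}" for i
  proof (rule linear_edges_linear_forest)
    show "linear_edges {e \<in> E. c e = i}" using lin_colD(3)[OF c, of i] by (simp add: color_class_def)
    show "simple_graph V {e \<in> E. c e = i}" using assms(3) by (simp add: simple_graph_def)
  qed
  then have "linear_coloring k V E c" using c by (auto simp: linear_coloring_def lin_col_def)
  then show ?thesis unfolding linear_arboricity_def by (auto intro: Least_le)
qed

end
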